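(* Let $\{X_i\}_{i\ge 1}$ be i.i.d. random variables with continuous density $f$ and cumulative distribution function $F(y)=\mathbb{P}(X_1<y)=\int_0^y f(z)\,dz$. Let $\{n_t\}_{t\ge 1}$ be a strictly increasing sequence of positive integers with comparison sets $\mathcal{C}(n_t)\subseteq\{1,2,\ldots,n_t-1\}$ such that (i) $\mathcal{C}(n_1)\subsetneq \mathcal{C}(n_2)\subsetneq\cdots$ and (ii) $n_{t-1}\in\mathcal{C}(n_t)$ for all $t\ge 2$. Let $A_{n_t}=\{X_{n_t}>\max_{j\in\mathcal{C}(n_t)}X_j\}$, let $c(n_t)=\#\mathcal{C}(n_t)+1$, and for $j\ge1$ let $$R_j=\sum_{1\le t\le j}\mathbf{1}(A_{n_t})$$ be the number of records in the first $j$ indices of the subsequence. Then for any $j\ge 2$, $$\mathbb{E}R_j=I_j:=\sum_{1\le t\le j}\frac{1}{c(n_t)}\quad\text{and}\quad \mathrm{var}(R_j)=I_j-\sum_{1\le t\le j}\frac{1}{c^2(n_t)}.$$ If $I_j\to\infty$ as $j\to\infty$, then $\frac{R_j}{I_j}\to 1$ almost surely as $j\to\infty$.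
   Context: The formula for $F$ means that the random variables are supported on $[0,\infty)$. $\#S$ denotes the cardinality of a finite set $S$, $\mathbf{1}(A)$ is the indicator of the event $A$, and $c^2(n_t)=(c(n_t))^2$. If a comparison set is empty, the corresponding maximum is taken to be $-\infty$, so that the record event always occurs. *)

theory Defs
  imports "HOL-Probability.Probability"
begin

(* Maximum of finitely many reals, with value -\<infinity> on the empty index set
   (Max {} is an unspecified value in the library). *)
definition cmp_max :: "(nat \<Rightarrow> real) \<Rightarrow> nat set \<Rightarrow> ereal" where
  "cmp_max x S = (if S = {} then -\<infinity> else ereal (Max (x ` S)))"

definition record_event ::
    "'a measure \<Rightarrow> (nat \<Rightarrow> 'a \<Rightarrow> real) \<Rightarrow> (nat \<Rightarrow> nat set) \<Rightarrow> nat \<Rightarrow> 'a set" where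
  "record_event M X C k =
     {\<omega> \<in> space M. cmp_max (\<lambda>j. X j \<omega>) (C k) < ereal (X k \<omega>)}"

definition record_count ::
    "'a measure \<Rightarrow> (nat \<Rightarrow> 'a \<Rightarrow> real) \<Rightarrow> (nat \<Rightarrow> nat set) \<Rightarrow> (nat \<Rightarrow> nat) \<Rightarrow> nat \<Rightarrow> 'a \<Rightarrow> real" where
  "record_count M X C n j \<omega> = (\<Sum>t=1..j. indicator (record_event M X C (n t)) \<omega>)"

definition cmp_size :: "(nat \<Rightarrow> nat set) \<Rightarrow> nat \<Rightarrow> nat" where
  "cmp_size C k = card (C k) + 1"

definition record_mean :: "(nat \<Rightarrow> nat set) \<Rightarrow> (nat \<Rightarrow> nat) \<Rightarrow> nat \<Rightarrow> real" where
  "record_mean C n j = (\<Sum>t=1..j. 1 / real (cmp_size C (n t)))"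

end

theory Submission
  imports Defs "HOL-Real_Asymp.Real_Asymp"
begin

text \<open>
  The record events of the subsequence are pairwise independent with probabilities
  \<open>1 / c(n\<^sub>t)\<close>; mean, variance and the strong law all follow from this alone.

  Both facts come from symmetry. The family \<open>X\<close> is exchangeable, because its joint law is a power of
  one measure (\<open>prob_permute\<close>), and ties have probability zero, because that measure has no atoms
  (\<open>AE_no_tie\<close>). Hence, almost surely, exactly one index of a finite set \<open>D\<close> carries the strict
  maximum, and each is equally likely to do so: the probability is \<open>1 / card D\<close>. With
  \<open>D\<^sub>t = C (n t) \<union> {n t}\<close>, the event \<open>A\<^sub>t\<close> says that \<open>n t\<close> leads \<open>D\<^sub>t\<close>. For \<open>s < t\<close> the two conditions
  on the comparison sets give \<open>D\<^sub>s \<subseteq> C (n t)\<close>. Exchanging two indices of \<open>D\<^sub>s\<close> therefore only permutes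
  the values that \<open>X (n t)\<close> has to exceed and leaves \<open>A\<^sub>t\<close> unchanged. So the same symmetry argument
  works inside \<open>A\<^sub>t\<close>: the leader of \<open>D\<^sub>s\<close> is still uniformly distributed on \<open>D\<^sub>s\<close>, that is
  \<open>P(A\<^sub>s \<inter> A\<^sub>t) = P(A\<^sub>t) / card D\<^sub>s\<close> (\<open>prob_leads_inter\<close>).

  For the strong law, pairwise independence gives \<open>var R\<^sub>j \<le> I\<^sub>j\<close>, so by Chebyshev a relative deviation
  of \<open>R\<^sub>j\<close> from \<open>I\<^sub>j\<close> by more than \<open>d\<close> has probability at most \<open>1 / (d\<^sup>2 I\<^sub>j)\<close>. Along the indices at
  which \<open>I\<close> first reaches \<open>k\<^sup>2\<close> these bounds are summable, and Borel-Cantelli gives convergence along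
  this subsequence. Since \<open>R\<close> and \<open>I\<close> are increasing and \<open>(k+1)\<^sup>2 / k\<^sup>2 \<longlonglongrightarrow> 1\<close>, the gaps are filled by
  monotonicity (\<open>ratio_tendsto_1_along_squares\<close>).
\<close>

section \<open>From a subsequence to the whole sequence\<close>

definition square_time :: "(nat \<Rightarrow> real) \<Rightarrow> nat \<Rightarrow> nat" where
  "square_time a k = (LEAST j. (real k)\<^sup>2 \<le> a j)"

text \<open>
  The normalizing sequence cannot jump over a square by more than one of its own increments, so it
  takes almost exactly the value \<open>k\<^sup>2\<close> at this index.
\<close>

lemma square_time_bounds:
  assumes lim: "filterlim a at_top sequentially"
    and a0: "a 0 = 0"
    and step: "\<And>j. a (Suc j) \<le> a j + 1"
  shows "(real k)\<^sup>2 \<le> a (square_time a k)"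
    and "a (square_time a k) \<le> (real k)\<^sup>2 + 1"
proof -
  have ex: "\<exists>j. (real k)\<^sup>2 \<le> a j"
    using lim eventually_happens'[OF sequentially_bot] unfolding filterlim_at_top by blast
  show low: "(real k)\<^sup>2 \<le> a (square_time a k)"
    unfolding square_time_def by (rule LeastI_ex[OF ex])
  show "a (square_time a k) \<le> (real k)\<^sup>2 + 1"
  proof (cases "square_time a k")
    case 0
    then show ?thesis using a0 by simp
  next
    case (Suc j)
    then have "\<not> (real k)\<^sup>2 \<le> a j"
      unfolding square_time_def by (intro not_less_Least) simp
    then show ?thesis using Suc step[of j] by simp
  qed
qed

text \<open>
  An index \<open>j\<close> with \<open>k\<^sup>2 \<le> a j < (k+1)\<^sup>2\<close> lies between the square times of \<open>k\<close> and \<open>k+1\<close>. By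
  monotonicity, \<open>r j / a j\<close> is at least the ratio at the first time divided by
  \<open>a (square_time a (k+1)) / a (square_time a k)\<close>, and at most the ratio at the second time multiplied
  by the same factor, which tends to \<open>1\<close>.
\<close>

lemma ratio_tendsto_1_along_squares:
  fixes a r :: "nat \<Rightarrow> real"
  assumes "mono a" and "mono r"
    and a0: "a 0 = 0" and r_nonneg: "\<And>j. 0 \<le> r j"
    and step: "\<And>j. a (Suc j) \<le> a j + 1"
    and lim: "filterlim a at_top sequentially"
    and sub: "(\<lambda>k. r (square_time a k) / a (square_time a k)) \<longlonglongrightarrow> 1"
  shows "(\<lambda>j. r j / a j) \<longlonglongrightarrow> 1"
proof -
  let ?T = "square_time a"
  note bounds = square_time_bounds[OF lim a0 step]
  have a_pos: "0 < a (?T k)" if "k > 0" for k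
    using bounds(1)[of k] that by (smt (verit) of_nat_0_less_iff zero_less_power)
  have quot: "(\<lambda>k. a (?T k) / a (?T (Suc k))) \<longlonglongrightarrow> 1"
  proof (rule tendsto_sandwich)
    show "\<forall>\<^sub>F k in sequentially. (real k)\<^sup>2 / ((real (Suc k))\<^sup>2 + 1) \<le> a (?T k) / a (?T (Suc k))"
    proof (intro always_eventually allI frac_le)
      fix k
      show "a (?T (Suc k)) \<le> (real (Suc k))\<^sup>2 + 1" by (rule bounds(2))
      show "0 \<le> a (?T k)" by (rule order_trans[OF zero_le_power2 bounds(1)])
    qed (use bounds(1) a_pos in auto)
    show "\<forall>\<^sub>F k in sequentially. a (?T k) / a (?T (Suc k)) \<le> ((real k)\<^sup>2 + 1) / (real (Suc k))\<^sup>2"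
    proof (intro always_eventually allI frac_le)
      fix k
      show "a (?T k) \<le> (real k)\<^sup>2 + 1" by (rule bounds(2))
      show "(real (Suc k))\<^sup>2 \<le> a (?T (Suc k))" by (rule bounds(1))
    qed auto
  qed real_asymp+
  define K where "K j = nat \<lfloor>sqrt (a j)\<rfloor>" for j
  have a_nonneg: "0 \<le> a j" for j
    using monoD[OF \<open>mono a\<close>, of 0 j] a0 by simp
  have K_low: "(real (K j))\<^sup>2 \<le> a j" for j
  proof -
    have "real (K j) \<le> sqrt (a j)" unfolding K_def using a_nonneg by simp
    then have "(real (K j))\<^sup>2 \<le> (sqrt (a j))\<^sup>2" by (intro power_mono) auto
    then show ?thesis using a_nonneg by simp
  qed
  have K_up: "a j < (real (Suc (K j)))\<^sup>2" for j
  proof -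
    have "sqrt (a j) < real (Suc (K j))" unfolding K_def using a_nonneg[of j] by simp linarith
    then have "(sqrt (a j))\<^sup>2 < (real (Suc (K j)))\<^sup>2" using a_nonneg by (intro power_strict_mono) auto
    then show ?thesis using a_nonneg by simp
  qed
  have K_lim: "filterlim K at_top sequentially"
    unfolding K_def
    by (intro filterlim_compose[OF filterlim_nat_sequentially] filterlim_compose[OF filterlim_floor_sequentially]
        filterlim_compose[OF sqrt_at_top] lim)
  have T_low: "?T (K j) \<le> j" for j
    unfolding square_time_def using K_low by (rule Least_le)
  have T_up: "j \<le> ?T (Suc (K j))" for j
  proof (rule ccontr)
    assume "\<not> ?thesis"
    then have "a (?T (Suc (K j))) \<le> a j" using \<open>mono a\<close> by (simp add: monoD)
    then show False using bounds(1)[of "Suc (K j)"] K_up[of j] by linarith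
  qed
  have K_pos: "\<forall>\<^sub>F j in sequentially. K j > 0"
    using eventually_compose_filterlim[OF eventually_gt_at_top K_lim] .
  show ?thesis
  proof (rule tendsto_sandwich)
    show "\<forall>\<^sub>F j in sequentially.
        r (?T (K j)) / a (?T (K j)) * (a (?T (K j)) / a (?T (Suc (K j)))) \<le> r j / a j"
      using K_pos
    proof eventually_elim
      case (elim j)
      have "r (?T (K j)) / a (?T (Suc (K j))) \<le> r j / a j"
        using monoD[OF \<open>mono r\<close> T_low[of j]] monoD[OF \<open>mono a\<close> T_up[of j]]
          monoD[OF \<open>mono a\<close> T_low[of j]] a_pos[OF elim] r_nonneg
        by (intro frac_le) auto
      then show ?case using a_pos[OF elim] by simp
    qed
    show "\<forall>\<^sub>F j in sequentially. r j / a j \<le>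
        r (?T (Suc (K j))) / a (?T (Suc (K j))) / (a (?T (K j)) / a (?T (Suc (K j))))"
      using K_pos
    proof eventually_elim
      case (elim j)
      have "r j / a j \<le> r (?T (Suc (K j))) / a (?T (K j))"
        using monoD[OF \<open>mono r\<close> T_up[of j]] monoD[OF \<open>mono a\<close> T_low[of j]] a_pos[OF elim] r_nonneg
        by (intro frac_le) auto
      then show ?case using a_pos[of "Suc (K j)"] by simp
    qed
    show "(\<lambda>j. r (?T (K j)) / a (?T (K j)) * (a (?T (K j)) / a (?T (Suc (K j))))) \<longlonglongrightarrow> 1"
      using filterlim_compose[OF tendsto_mult[OF sub quot] K_lim] by simp
    show "(\<lambda>j. r (?T (Suc (K j))) / a (?T (Suc (K j))) / (a (?T (K j)) / a (?T (Suc (K j))))) \<longlonglongrightarrow> 1"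
      using filterlim_compose[OF tendsto_divide[OF LIMSEQ_Suc[OF sub] quot] K_lim] by simp
  qed
qed

section \<open>Counting pairwise independent events\<close>

text \<open>
  The square of the count is a sum of indicators of pairwise intersections. Off the diagonal
  their probabilities factor as in the square of the mean; a diagonal term contributes
  \<open>P(A)\<close> in place of \<open>P(A)\<^sup>2\<close>.
\<close>

lemma (in prob_space) count_of_pairwise_independent_events:
  fixes A :: "'i \<Rightarrow> 'a set"
  assumes fin: "finite S"
    and ev: "\<And>t. t \<in> S \<Longrightarrow> A t \<in> events"
    and pair: "\<And>s t. s \<in> S \<Longrightarrow> t \<in> S \<Longrightarrow> s \<noteq> t \<Longrightarrow> prob (A s \<inter> A t) = prob (A s) * prob (A t)"
  defines "R \<equiv> \<lambda>\<omega>. \<Sum>t\<in>S. indicator (A t) \<omega> :: real"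
  shows "integrable M (\<lambda>\<omega>. (R \<omega>)\<^sup>2)"
    and "expectation R = (\<Sum>t\<in>S. prob (A t))"
    and "variance R = (\<Sum>t\<in>S. prob (A t)) - (\<Sum>t\<in>S. (prob (A t))\<^sup>2)"
proof -
  let ?p = "\<lambda>t. prob (A t)"
  have ind_int: "integrable M (indicator B :: 'a \<Rightarrow> real)" if "B \<in> events" for B
    using that by (simp add: integrable_indicator_iff emeasure_eq_measure)
  have sq: "(\<lambda>\<omega>. (R \<omega>)\<^sup>2) = (\<lambda>\<omega>. \<Sum>s\<in>S. \<Sum>t\<in>S. indicator (A s \<inter> A t) \<omega>)"
    by (simp add: R_def power2_eq_square sum_product indicator_inter_arith)
  show sq_int: "integrable M (\<lambda>\<omega>. (R \<omega>)\<^sup>2)"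
    unfolding sq using ev by (intro Bochner_Integration.integrable_sum ind_int) auto
  have R_int: "integrable M R"
    unfolding R_def using ev by (intro Bochner_Integration.integrable_sum ind_int) auto
  show mean: "expectation R = (\<Sum>t\<in>S. ?p t)"
    unfolding R_def using ev
    by (subst Bochner_Integration.integral_sum) (auto intro!: ind_int sum.cong)
  have "expectation (\<lambda>\<omega>. (R \<omega>)\<^sup>2) = (\<Sum>s\<in>S. \<Sum>t\<in>S. prob (A s \<inter> A t))"
    unfolding sq using ev
    by (subst Bochner_Integration.integral_sum;
        (intro sum.cong refl, subst Bochner_Integration.integral_sum)?)
       (auto intro!: Bochner_Integration.integrable_sum ind_int sum.cong)
  also have "\<dots> = (\<Sum>s\<in>S. \<Sum>t\<in>S. ?p s * ?p t + (if s = t then ?p s - (?p s)\<^sup>2 else 0))"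
    by (intro sum.cong refl) (auto simp: pair power2_eq_square)
  also have "\<dots> = (\<Sum>t\<in>S. ?p t)\<^sup>2 + (\<Sum>s\<in>S. ?p s - (?p s)\<^sup>2)"
    unfolding sum.distrib power2_eq_square[of "sum _ _"] sum_product using fin by simp
  finally show "variance R = (\<Sum>t\<in>S. ?p t) - (\<Sum>t\<in>S. (?p t)\<^sup>2)"
    using variance_eq[OF R_int sq_int] mean by (simp add: sum_subtractf)
qed

text \<open>
  Chebyshev's inequality involves only second moments, so pairwise independence suffices: the
  deviation bounds are summable along the square times, and monotonicity does the rest.
\<close>

theorem (in prob_space) strong_law_pairwise_independent_events:
  fixes A :: "nat \<Rightarrow> 'a set"
  assumes ev: "\<And>t. t \<ge> 1 \<Longrightarrow> A t \<in> events"
    and pair: "\<And>s t. s \<ge> 1 \<Longrightarrow> t \<ge> 1 \<Longrightarrow> s \<noteq> t \<Longrightarrow> prob (A s \<inter> A t) = prob (A s) * prob (A t)"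
    and lim: "filterlim (\<lambda>j. \<Sum>t=1..j. prob (A t)) at_top sequentially"
  shows "AE \<omega> in M. (\<lambda>j. (\<Sum>t=1..j. indicator (A t) \<omega>) / (\<Sum>t=1..j. prob (A t))) \<longlonglongrightarrow> 1"
proof -
  define a where "a j = (\<Sum>t=1..j. prob (A t))" for j
  define R where "R j \<omega> = (\<Sum>t=1..j. indicator (A t) \<omega> :: real)" for j \<omega>
  let ?T = "square_time a"
  have a_lim: "filterlim a at_top sequentially"
    using lim by (simp add: a_def[abs_def])
  have a0: "a 0 = 0" by (simp add: a_def)
  have step: "a (Suc j) \<le> a j + 1" for j by (simp add: a_def)
  note bounds = square_time_bounds[OF a_lim a0 step]
  have R_meas [measurable]: "R j \<in> borel_measurable M" for j
    unfolding R_def using ev by (intro borel_measurable_sum borel_measurable_indicator) auto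
  have deviation: "prob {\<omega>\<in>space M. \<bar>R j \<omega> - a j\<bar> \<ge> d * a j} \<le> 1 / (d\<^sup>2 * a j)"
    if "d > 0" "a j > 0" for d j
  proof -
    have E: "expectation (R j) = a j"
      and V: "variance (R j) = a j - (\<Sum>t=1..j. (prob (A t))\<^sup>2)"
      and I: "integrable M (\<lambda>\<omega>. (R j \<omega>)\<^sup>2)"
      using count_of_pairwise_independent_events[of "{1..j}" A] ev pair
      by (auto simp: R_def[abs_def] a_def)
    have "prob {\<omega>\<in>space M. \<bar>R j \<omega> - a j\<bar> \<ge> d * a j} \<le> variance (R j) / (d * a j)\<^sup>2"
      using Chebyshev_inequality[OF R_meas I, of "d * a j"] that E by simp
    also have "\<dots> \<le> a j / (d * a j)\<^sup>2"
      unfolding V by (intro divide_right_mono) (auto intro: sum_nonneg)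
    also have "\<dots> = 1 / (d\<^sup>2 * a j)" using that by (simp add: power2_eq_square)
    finally show ?thesis .
  qed
  have close: "AE \<omega> in M. \<forall>\<^sub>F k in sequentially. \<bar>R (?T k) \<omega> - a (?T k)\<bar> < d * a (?T k)"
    if d: "d > 0" for d
  proof -
    let ?B = "\<lambda>k. {\<omega>\<in>space M. \<bar>R (?T k) \<omega> - a (?T k)\<bar> \<ge> d * a (?T k)}"
    have "AE \<omega> in M. \<forall>\<^sub>F k in sequentially. \<omega> \<in> space M - ?B k"
    proof (rule borel_cantelli_AE1)
      show "summable (\<lambda>k. prob (?B k))"
      proof (rule summable_comparison_test_ev)
        show "summable (\<lambda>k. 1 / d\<^sup>2 * (1 / (real k)\<^sup>2))"
          using inverse_power_summable[of 2, where ?'a=real]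
          by (intro summable_mult) (simp add: inverse_eq_divide)
        show "\<forall>\<^sub>F k in sequentially. norm (prob (?B k)) \<le> 1 / d\<^sup>2 * (1 / (real k)\<^sup>2)"
          using eventually_gt_at_top[of 0]
        proof eventually_elim
          case (elim k)
          then have k: "0 < (real k)\<^sup>2" by simp
          have "0 < a (?T k)" using k bounds(1)[of k] by linarith
          have "prob (?B k) \<le> 1 / (d\<^sup>2 * a (?T k))"
            using d \<open>0 < a (?T k)\<close> by (intro deviation) auto
          also have "\<dots> \<le> 1 / (d\<^sup>2 * (real k)\<^sup>2)"
            using k bounds(1)[of k] d \<open>0 < a (?T k)\<close>
            by (intro divide_left_mono mult_left_mono mult_pos_pos) auto
          finally show ?case by simp
        qed
      qed
    qed (auto simp: emeasure_eq_measure)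
    then show ?thesis
    proof eventually_elim
      case (elim \<omega>)
      then show ?case by (rule eventually_mono) auto
    qed
  qed
  \<comment> \<open>Countably many tolerances keep the exceptional set null.\<close>
  have "AE \<omega> in M. \<forall>m. \<forall>\<^sub>F k in sequentially.
      \<bar>R (?T k) \<omega> - a (?T k)\<bar> < 1 / real (Suc m) * a (?T k)"
    unfolding AE_all_countable by (intro allI close) simp
  then show ?thesis
  proof eventually_elim
    case (elim \<omega>)
    have "(\<lambda>k. R (?T k) \<omega> / a (?T k)) \<longlonglongrightarrow> 1"
    proof (rule tendstoI)
      fix e :: real assume "e > 0"
      then obtain m where m: "1 / real (Suc m) < e" by (meson nat_approx_posE)
      have "\<forall>\<^sub>F k in sequentially. \<bar>R (?T k) \<omega> - a (?T k)\<bar> < 1 / real (Suc m) * a (?T k)"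
        using elim by blast
      then show "\<forall>\<^sub>F k in sequentially. dist (R (?T k) \<omega> / a (?T k)) 1 < e"
        using eventually_gt_at_top[of 0]
      proof eventually_elim
        case (elim k)
        then have pos: "a (?T k) > 0"
          using bounds(1)[of k] by (smt (verit) of_nat_0_less_iff zero_less_power)
        have "dist (R (?T k) \<omega> / a (?T k)) 1 = \<bar>R (?T k) \<omega> - a (?T k)\<bar> / a (?T k)"
          using pos by (simp add: dist_real_def diff_divide_distrib[symmetric] abs_divide field_simps)
        also have "\<dots> < 1 / real (Suc m)"
          using elim(1) pos by (simp add: divide_less_eq)
        finally show ?case using m by simp
      qed
    qed
    then have "(\<lambda>j. R j \<omega> / a j) \<longlonglongrightarrow> 1"
      by (intro ratio_tendsto_1_along_squares[OF _ _ a0 _ step a_lim])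
         (auto simp: R_def a_def mono_iff_le_Suc intro: sum_nonneg)
    then show ?case by (simp add: R_def a_def)
  qed
qed

section \<open>Leaders of an exchangeable family\<close>

locale iid_atomless_family = prob_space M
  for M :: "'a measure" and X :: "'i \<Rightarrow> 'a \<Rightarrow> real" and I :: "'i set" and N :: "real measure" +
  assumes indep: "indep_vars (\<lambda>_. borel) X I"
    and law: "\<And>i. i \<in> I \<Longrightarrow> distr M borel (X i) = N"
    and atomless: "\<And>x. emeasure N {x} = 0"
begin

abbreviation sample :: "'a \<Rightarrow> 'i \<Rightarrow> real" where
  "sample \<omega> \<equiv> \<lambda>i\<in>I. X i \<omega>"

text \<open>
  A predicate on coordinate vectors rather than an event in the probability space, so that
  permutations of the coordinates can act on it.
\<close>
definition leads :: "'i set \<Rightarrow> 'i \<Rightarrow> ('i \<Rightarrow> real) \<Rightarrow> bool" where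
  "leads D k v \<longleftrightarrow> (\<forall>j\<in>D - {k}. v j < v k)"

lemma rv [measurable]: "i \<in> I \<Longrightarrow> random_variable borel (X i)"
  using indep by (simp add: indep_vars_def2)

lemma sample_measurable [measurable]: "sample \<in> measurable M (\<Pi>\<^sub>M i\<in>I. borel)"
  by (rule measurable_restrict) simp

lemma pred_leads:
  assumes "D \<subseteq> I" "k \<in> I" "finite D"
  shows "Measurable.pred (\<Pi>\<^sub>M i\<in>I. borel) (leads D k)"
proof -
  have "Measurable.pred (\<Pi>\<^sub>M i\<in>I. (borel :: real measure)) (\<lambda>v. \<forall>j\<in>D - {k}. v j < v k)"
    unfolding pred_def using assms
    by (intro sets.sets_Collect_finite_All borel_measurable_less measurable_component_singleton) auto
  then show ?thesis by (simp add: leads_def[abs_def])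
qed

text \<open>
  Exchangeability: the joint law is a product of copies of one measure, and relabelling the
  coordinates preserves such a product.
\<close>

lemma prob_permute:
  assumes \<pi>: "bij_betw \<pi> I I" and Q: "Measurable.pred (\<Pi>\<^sub>M i\<in>I. borel) Q"
  shows "prob {\<omega>\<in>space M. Q (\<lambda>i\<in>I. sample \<omega> (\<pi> i))} = prob {\<omega>\<in>space M. Q (sample \<omega>)}"
proof (cases "I = {}")
  case True
  then have "(\<lambda>i\<in>I. sample \<omega> (\<pi> i)) = sample \<omega>" for \<omega>
    by (simp add: fun_eq_iff)
  then show ?thesis by simp
next
  case False
  let ?P = "\<Pi>\<^sub>M i\<in>I. (borel :: real measure)"
  let ?s = "\<lambda>v. \<lambda>i\<in>I. v (\<pi> i) :: real"
  have \<pi>_in: "\<pi> i \<in> I" if "i \<in> I" for i using \<pi> that by (auto simp: bij_betw_def)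
  have N_prob: "prob_space N"
    using False law prob_space_distr[OF rv] by (metis ex_in_conv)
  have N_sets: "sets N = sets borel" using False law by (metis ex_in_conv sets_distr)
  have sets_PN: "sets (\<Pi>\<^sub>M i\<in>I. N) = sets ?P"
    by (intro sets_PiM_cong refl N_sets)
  have s_meas [measurable]: "?s \<in> measurable ?P ?P"
    using \<pi>_in by (intro measurable_restrict measurable_component_singleton) auto
  have law_sample: "distr M ?P sample = (\<Pi>\<^sub>M i\<in>I. N)"
    using indep_vars_iff_distr_eq_PiM'[where M'="\<lambda>_. borel" and X=X, OF False] indep law
    by (simp add: rv cong: PiM_cong)
  have "distr M ?P (\<lambda>\<omega>. ?s (sample \<omega>)) = distr (distr M ?P sample) ?P ?s"
    by (simp add: distr_distr comp_def)
  also have "\<dots> = distr (\<Pi>\<^sub>M i\<in>I. N) (\<Pi>\<^sub>M i\<in>I. N) ?s"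
    unfolding law_sample by (intro distr_cong refl sets_PN[symmetric])
  also have "\<dots> = (\<Pi>\<^sub>M i\<in>I. N)"
    using distr_PiM_reindex[of I "\<lambda>_. N" \<pi> I] N_prob \<pi> \<pi>_in by (auto simp: bij_betw_def)
  finally have eq: "distr M ?P (\<lambda>\<omega>. ?s (sample \<omega>)) = distr M ?P sample"
    using law_sample by simp
  have Qset: "{v\<in>space ?P. Q v} \<in> sets ?P" using Q by (simp add: pred_def)
  have pull: "measure (distr M ?P g) {v\<in>space ?P. Q v} = prob {\<omega>\<in>space M. Q (g \<omega>)}"
    if "g \<in> measurable M ?P" for g
    using measure_distr[OF that Qset] measurable_space[OF that]
    by (auto intro!: arg_cong[where f=prob])
  note pull[OF measurable_compose[OF sample_measurable s_meas]]
  moreover note pull[OF sample_measurable]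
  ultimately show ?thesis using eq by simp
qed

text \<open>
  The pair has law \<open>N \<Otimes>\<^sub>M N\<close>, and every section of the diagonal is a single point.
\<close>

lemma AE_no_tie:
  assumes "i \<in> I" "j \<in> I" "i \<noteq> j"
  shows "AE \<omega> in M. X i \<omega> \<noteq> X j \<omega>"
proof -
  interpret N: prob_space N
    using prob_space_distr[OF rv[OF assms(1)]] law[OF assms(1)] by simp
  interpret NN: pair_sigma_finite N N ..
  have N_sets [measurable_cong]: "sets N = sets borel" using law[OF assms(1)] by (metis sets_distr)
  have ind: "indep_var borel (X i) borel (X j)"
  proof -
    have "indep_var borel ((\<lambda>v. v i) \<circ> (\<lambda>\<omega>. \<lambda>k\<in>{i}. X k \<omega>)) borel ((\<lambda>v. v j) \<circ> (\<lambda>\<omega>. \<lambda>k\<in>{j}. X k \<omega>))"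
      using assms by (intro indep_var_compose[OF indep_var_restrict[OF indep]]) auto
    then show ?thesis by (simp add: comp_def)
  qed
  have joint: "distr M (borel \<Otimes>\<^sub>M borel) (\<lambda>\<omega>. (X i \<omega>, X j \<omega>)) = N \<Otimes>\<^sub>M N"
    using ind law assms by (simp add: indep_var_distribution_eq)
  have "AE z in N \<Otimes>\<^sub>M N. fst z \<noteq> snd z"
  proof (rule NN.AE_pair_measure)
    show "{z \<in> space (N \<Otimes>\<^sub>M N). fst z \<noteq> snd z} \<in> sets (N \<Otimes>\<^sub>M N)"
      by measurable
    show "AE x in N. AE y in N. fst (x, y) \<noteq> snd (x, y)"
      using atomless N_sets by (intro AE_I2 AE_I[of _ _ "{_}"]) auto
  qed
  then have "AE z in distr M (borel \<Otimes>\<^sub>M borel) (\<lambda>\<omega>. (X i \<omega>, X j \<omega>)). fst z \<noteq> snd z"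
    by (subst joint)
  then show ?thesis
    using assms by (subst (asm) AE_distr_iff) (auto intro!: measurable_Pair)
qed

text \<open>
  An event that is unaffected by exchanging \<open>k\<close> with any index of \<open>D\<close> splits, up to ties, into one
  piece for each possible leader of \<open>D\<close>, and these pieces are carried to one another by the
  exchanges. So each of them has the same share \<open>1 / card D\<close> of its probability.
\<close>

lemma prob_leads_inter:
  assumes D: "D \<subseteq> I" "finite D" "k \<in> D"
    and Q: "Measurable.pred (\<Pi>\<^sub>M i\<in>I. borel) Q"
    and inv: "\<And>v l. l \<in> D \<Longrightarrow> Q (\<lambda>i\<in>I. v (Transposition.transpose k l i)) = Q v"
  shows "prob {\<omega>\<in>space M. leads D k (sample \<omega>) \<and> Q (sample \<omega>)} = prob {\<omega>\<in>space M. Q (sample \<omega>)} / card D"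
proof -
  let ?E = "\<lambda>l. {\<omega>\<in>space M. leads D l (sample \<omega>) \<and> Q (sample \<omega>)}"
  have pred: "Measurable.pred (\<Pi>\<^sub>M i\<in>I. borel) (\<lambda>v. leads D l v \<and> Q v)" if "l \<in> D" for l
    using pred_leads[of D l] that D Q by (intro pred_intros_logic) auto
  have E_meas: "?E l \<in> events" if "l \<in> D" for l
    using measurable_compose[OF sample_measurable pred[OF that]] by (simp add: pred_def)
  have Q_meas: "{\<omega>\<in>space M. Q (sample \<omega>)} \<in> events"
    using measurable_compose[OF sample_measurable Q] by (simp add: pred_def)
  have same: "prob (?E l) = prob (?E k)" if l: "l \<in> D" for l
  proof -
    let ?\<tau> = "Transposition.transpose k l"
    have bij: "bij_betw ?\<tau> I I"
      using D l by (intro bij_betw_transpose_iff) auto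
    have swap: "leads D k (\<lambda>i\<in>I. sample \<omega> (?\<tau> i)) = leads D l (sample \<omega>)" for \<omega>
    proof -
      have "leads D k (\<lambda>i\<in>I. sample \<omega> (?\<tau> i)) \<longleftrightarrow> (\<forall>j\<in>D - {k}. sample \<omega> (?\<tau> j) < sample \<omega> l)"
        using D by (auto simp: leads_def)
      also have "\<dots> \<longleftrightarrow> (\<forall>j\<in>?\<tau> ` (D - {k}). sample \<omega> j < sample \<omega> l)" by simp
      also have "?\<tau> ` (D - {k}) = D - {l}"
        using D l by (auto simp: Transposition.transpose_def image_iff split: if_splits)
      finally show ?thesis by (simp add: leads_def)
    qed
    show ?thesis
      using prob_permute[OF bij pred[OF D(3)]] unfolding swap inv[OF l] .
  qed
  have "AE \<omega> in M. \<forall>i\<in>D. \<forall>j\<in>D. i \<noteq> j \<longrightarrow> X i \<omega> \<noteq> X j \<omega>"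
    using D AE_no_tie by (intro AE_finite_allI) auto
  then have "AE \<omega> in M. \<omega> \<in> {\<omega>\<in>space M. Q (sample \<omega>)} \<longleftrightarrow> \<omega> \<in> (\<Union>l\<in>D. ?E l)"
  proof eventually_elim
    case (elim \<omega>)
    have "\<exists>l\<in>D. leads D l (sample \<omega>)"
    proof -
      have "Max ((\<lambda>i. X i \<omega>) ` D) \<in> (\<lambda>i. X i \<omega>) ` D"
        using D by (intro Max_in) auto
      then obtain l where l: "l \<in> D" "X l \<omega> = Max ((\<lambda>i. X i \<omega>) ` D)" by auto
      have "X j \<omega> < X l \<omega>" if "j \<in> D - {l}" for j
      proof -
        have "X j \<omega> \<le> X l \<omega>" using l(2) that D by simp
        moreover have "X j \<omega> \<noteq> X l \<omega>" using elim l(1) that by blast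
        ultimately show ?thesis by simp
      qed
      then show ?thesis using l D unfolding leads_def by (intro bexI[of _ l]) auto
    qed
    then show ?case by auto
  qed
  then have "prob {\<omega>\<in>space M. Q (sample \<omega>)} = prob (\<Union>l\<in>D. ?E l)"
    using E_meas Q_meas D by (intro finite_measure_eq_AE) auto
  also have "\<dots> = (\<Sum>l\<in>D. prob (?E l))"
  proof (rule finite_measure_finite_Union)
    have "\<not> (leads D a v \<and> leads D b v)" if "a \<in> D" "b \<in> D" "a \<noteq> b" for a b v
      using that less_asym unfolding leads_def by blast
    then show "disjoint_family_on ?E D"
      unfolding disjoint_family_on_def by blast
  qed (use D E_meas in auto)
  also have "\<dots> = card D * prob (?E k)"
    using same by simp
  finally show ?thesis using D by (auto simp: card_gt_0_iff field_simps)
qed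

lemma prob_leads:
  assumes "D \<subseteq> I" "finite D" "k \<in> D"
  shows "prob {\<omega>\<in>space M. leads D k (sample \<omega>)} = 1 / card D"
  using prob_leads_inter[OF assms, of "\<lambda>_. True"] by (simp add: prob_space)

text \<open>
  This is where the independence comes from: whether \<open>m\<close> leads \<open>T\<close> depends on the coordinates in \<open>S\<close>
  only through their set of values, so it carries no information on which index leads \<open>S\<close>.
\<close>

lemma prob_leads_nested:
  assumes S: "S \<subseteq> T - {m}" "k \<in> S" and T: "T \<subseteq> I" "finite T" "m \<in> T"
  shows "prob {\<omega>\<in>space M. leads S k (sample \<omega>) \<and> leads T m (sample \<omega>)} = 1 / card S * (1 / card T)"
proof -
  have "leads T m (\<lambda>i\<in>I. v (Transposition.transpose k l i)) = leads T m v" if l: "l \<in> S" for v l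
  proof -
    let ?\<tau> = "Transposition.transpose k l"
    have fix_m: "?\<tau> m = m" using S l by (auto simp: Transposition.transpose_def)
    have "leads T m (\<lambda>i\<in>I. v (?\<tau> i)) \<longleftrightarrow> (\<forall>j\<in>T - {m}. v (?\<tau> j) < v m)"
      using T fix_m by (auto simp: leads_def)
    also have "\<dots> \<longleftrightarrow> (\<forall>j\<in>?\<tau> ` (T - {m}). v j < v m)" by simp
    also have "?\<tau> ` (T - {m}) = T - {m}"
      using S l by (auto simp: Transposition.transpose_def image_iff split: if_splits)
    finally show ?thesis by (simp add: leads_def)
  qed
  then have "prob {\<omega>\<in>space M. leads S k (sample \<omega>) \<and> leads T m (sample \<omega>)}
      = prob {\<omega>\<in>space M. leads T m (sample \<omega>)} / card S"
    using S T by (intro prob_leads_inter pred_leads) (blast intro: finite_subset)+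
  then show ?thesis using prob_leads[OF T] by simp
qed

end

section \<open>Records\<close>

lemma cmp_max_less_iff:
  assumes "finite S"
  shows "cmp_max x S < ereal y \<longleftrightarrow> (\<forall>j\<in>S. x j < y)"
  using assms by (auto simp: cmp_max_def)

theorem theorem2:
  fixes M :: "'a measure"
    and X :: "nat \<Rightarrow> 'a \<Rightarrow> real"
    and f F :: "real \<Rightarrow> real"
    and n :: "nat \<Rightarrow> nat"
    and C :: "nat \<Rightarrow> nat set"
  assumes "prob_space M"
    and indep: "prob_space.indep_vars M (\<lambda>_. borel) X {1..}"
    and ident: "\<And>i. i \<ge> 1 \<Longrightarrow> distr M borel (X i) = distr M borel (X 1)"
    and dens: "distributed M lborel (X 1) (\<lambda>x. ennreal (f x))"
    and f_nonneg: "\<And>x. f x \<ge> 0"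
    and f_supp: "\<And>x. x < 0 \<Longrightarrow> f x = 0"
    and f_cont: "continuous_on {0..} f"
    and F_def: "\<And>y. F y = measure M {\<omega> \<in> space M. X 1 \<omega> < y}"
    and F_int: "\<And>y. F y = (LINT z:{0..y}|lborel. f z)"
    and n_pos: "\<And>t. t \<ge> 1 \<Longrightarrow> n t \<ge> 1"
    and n_mono: "strict_mono_on {1..} n"
    and C_sub: "\<And>t. t \<ge> 1 \<Longrightarrow> C (n t) \<subseteq> {1..<n t}"
    and C_chain: "\<And>t. t \<ge> 1 \<Longrightarrow> C (n t) \<subset> C (n (t + 1))"
    and C_prev: "\<And>t. t \<ge> 2 \<Longrightarrow> n (t - 1) \<in> C (n t)"
  shows "(\<forall>j\<ge>2.
            prob_space.expectation M (record_count M X C n j) = record_mean C n j \<and>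
            prob_space.variance M (record_count M X C n j) =
              record_mean C n j - (\<Sum>t=1..j. 1 / (real (cmp_size C (n t)))\<^sup>2)) \<and>
         (filterlim (record_mean C n) at_top sequentially \<longrightarrow>
            (AE \<omega> in M. (\<lambda>j. record_count M X C n j \<omega> / record_mean C n j) \<longlonglongrightarrow> 1))"
proof -
  interpret prob_space M by fact
  interpret iid_atomless_family M X "{1..}" "distr M borel (X 1)"
  proof unfold_locales
    show "indep_vars (\<lambda>_. borel) X {1..}" by (rule indep)
    show "distr M borel (X i) = distr M borel (X 1)" if "i \<in> {1..}" for i
      using that by (intro ident) simp
    have f_meas: "(\<lambda>x. ennreal (f x)) \<in> borel_measurable lborel"
      using dens by (rule distributed_borel_measurable)
    have "distr M borel (X 1) = distr M lborel (X 1)"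
      by (rule distr_cong) auto
    also have "\<dots> = density lborel (\<lambda>x. ennreal (f x))"
      using dens by (rule distributed_distr_eq_density)
    finally have law_1: "distr M borel (X 1) = density lborel (\<lambda>x. ennreal (f x))" .
    show "emeasure (distr M borel (X 1)) {x} = 0" for x
    proof -
      have "{x} \<in> null_sets lborel" by (intro null_setsI) auto
      then show ?thesis
        unfolding law_1 using absolutely_continuousI_density[OF f_meas]
        unfolding absolutely_continuous_def by blast
    qed
  qed
  define A where "A t = record_event M X C (n t)" for t
  \<comment> \<open>The time of the possible record is added to its comparison set, so that a record means that
    the time leads a set of size \<open>c(n\<^sub>t)\<close>.\<close>
  define D where "D t = insert (n t) (C (n t))" for t
  have C_fin: "finite (C (n t))" if "t \<ge> 1" for t
    using C_sub[OF that] by (rule finite_subset) simp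
  have n_notin: "n t \<notin> C (n t)" if "t \<ge> 1" for t
    using C_sub[OF that] by auto
  have D_props: "D t \<subseteq> {1..}" "finite (D t)" "n t \<in> D t" "card (D t) = cmp_size C (n t)" if "t \<ge> 1" for t
    using C_sub[OF that] C_fin[OF that] n_notin[OF that] n_pos[OF that]
    by (auto simp: D_def cmp_size_def)
  have A_leads: "A t = {\<omega>\<in>space M. leads (D t) (n t) (sample \<omega>)}" if "t \<ge> 1" for t
    using C_sub[OF that] n_pos[OF that] n_notin[OF that] C_fin[OF that]
    by (auto simp: A_def D_def record_event_def cmp_max_less_iff leads_def)
  have A_meas: "A t \<in> events" if "t \<ge> 1" for t
    using measurable_compose[OF sample_measurable pred_leads[of "D t" "n t"]] D_props[OF that]
    by (simp add: A_leads[OF that] pred_def subset_iff)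
  have A_prob: "prob (A t) = 1 / real (cmp_size C (n t))" if "t \<ge> 1" for t
    using prob_leads D_props[OF that] by (simp add: A_leads[OF that])
  have C_mono: "C (n s) \<subseteq> C (n t)" if "1 \<le> s" "s \<le> t" for s t
    using that(2)
  proof (induction t rule: dec_induct)
    case (step m)
    then show ?case using C_chain[of m] that(1) by auto
  qed simp
  have D_nested: "D s \<subseteq> D t - {n t}" if "1 \<le> s" "s < t" for s t
  proof -
    have "D s \<subseteq> C (n (s + 1))"
      using C_chain[of s] C_prev[of "s + 1"] that by (auto simp: D_def)
    also have "\<dots> \<subseteq> C (n t)" using that by (intro C_mono) auto
    finally show ?thesis using n_notin[of t] that by (auto simp: D_def)
  qed
  have A_pair_less: "prob (A s \<inter> A t) = prob (A s) * prob (A t)" if "1 \<le> s" "s < t" for s t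
  proof -
    have "A s \<inter> A t = {\<omega>\<in>space M. leads (D s) (n s) (sample \<omega>) \<and> leads (D t) (n t) (sample \<omega>)}"
      using that by (auto simp: A_leads)
    then show ?thesis
      using prob_leads_nested[OF D_nested[OF that]] D_props[of s] D_props[of t] that
      by (simp add: A_prob)
  qed
  have A_pair: "prob (A s \<inter> A t) = prob (A s) * prob (A t)" if "s \<ge> 1" "t \<ge> 1" "s \<noteq> t" for s t
    using A_pair_less[of s t] A_pair_less[of t s] that
    by (cases "s < t") (auto simp: Int_commute mult.commute)
  have count: "record_count M X C n j = (\<lambda>\<omega>. \<Sum>t\<in>{1..j}. indicator (A t) \<omega>)" for j
    by (simp add: record_count_def[abs_def] A_def)
  have mean: "record_mean C n j = (\<Sum>t\<in>{1..j}. prob (A t))" for j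
    by (simp add: record_mean_def A_prob)
  have squares: "(\<Sum>t=1..j. 1 / (real (cmp_size C (n t)))\<^sup>2) = (\<Sum>t\<in>{1..j}. (prob (A t))\<^sup>2)" for j
    by (simp add: A_prob power_divide)
  have mean_variance: "expectation (\<lambda>\<omega>. \<Sum>t\<in>{1..j}. indicator (A t) \<omega>) = (\<Sum>t\<in>{1..j}. prob (A t))"
      "variance (\<lambda>\<omega>. \<Sum>t\<in>{1..j}. indicator (A t) \<omega>) =
        (\<Sum>t\<in>{1..j}. prob (A t)) - (\<Sum>t\<in>{1..j}. (prob (A t))\<^sup>2)" for j
    using count_of_pairwise_independent_events(2,3)[of "{1..j}" A] A_meas A_pair by simp_all
  show ?thesis
  proof (intro conjI impI allI)
    fix j :: nat
    show "expectation (record_count M X C n j) = record_mean C n j"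
      unfolding count mean by (rule mean_variance(1))
    show "variance (record_count M X C n j) =
        record_mean C n j - (\<Sum>t=1..j. 1 / (real (cmp_size C (n t)))\<^sup>2)"
      unfolding count mean squares by (rule mean_variance(2))
  next
    assume "filterlim (record_mean C n) at_top sequentially"
    then have "filterlim (\<lambda>j. \<Sum>t=1..j. prob (A t)) at_top sequentially"
      by (simp add: mean[abs_def])
    then show "AE \<omega> in M. (\<lambda>j. record_count M X C n j \<omega> / record_mean C n j) \<longlonglongrightarrow> 1"
      unfolding count mean by (intro strong_law_pairwise_independent_events A_meas A_pair)
  qed
qed

end
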